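(* Let $\mathcal T=\{(P_1,B_1),\dots,(P_r,B_r)\}$ be a finite set of templates such that each binary string $B_i$ contains at most $k$ zeros, and let $\sigma$ be a pattern (permutation) of length $l>0$. If there exists $n$ such that $S_{n,\mathcal T}$ contains a permutation containing $\sigma$ as a pattern, then there exists $m\le (l-1)(k+1)+1$ such that $S_{m,\mathcal T}$ contains a permutation containing $\sigma$ as a pattern.
   Context: A permutation $\pi$ contains a pattern $\sigma$ if some subsequence of $\pi$ is order-isomorphic to $\sigma$. A template of length $t\ge1$ is a pair $T=(P,B)$ where $P=p_1\cdots p_t$ is a permutation of $\{1,\dots,t\}$ and $B=b_1\cdots b_t$ is a binary string of length $t$. For a set $\mathcal T$ of templates, the sets $S_{n,\mathcal T}$ of permutations of length $n$ are defined recursively: $S_{0,\mathcal T}$ consists of the empty permutation and $S_{1,\mathcal T}=\{1\}$; for $n\ge2$, $S_{n,\mathcal T}$ is the set of permutations $\pi$ of length $n$ for which there is some template $T=(P,B)\in\mathcal T$ of length $t$ such that $\pi$ can be divided into consecutive (possibly empty) subwords $W_1,\dots,W_t$ (so $\pi=W_1W_2\cdots W_t$) with: whenever $p_i>p_j$, every entry of $W_i$ is greater than every entry of $W_j$; each $W_i$ of length $l$, viewed up to order-isomorphism (standardized to a permutation of $\{1,\dots,l\}$), is an element of $S_{l,\mathcal T}$; and whenever $b_i=0$, $W_i$ has exactly one element. *)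

theory Defs
  imports "HOL-Combinatorics.Multiset_Permutations" "HOL-Library.Sublist"
begin

text \<open>
  A permutation of length \<open>n\<close> is given in one-line notation, as a list in
  \<^term>\<open>permutations_of_set {1..n::nat}\<close>.
\<close>

definition order_isomorphic :: "nat list \<Rightarrow> nat list \<Rightarrow> bool" where
  "order_isomorphic xs ys \<longleftrightarrow> length xs = length ys \<and>
     (\<forall>i<length xs. \<forall>j<length xs. xs ! i < xs ! j \<longleftrightarrow> ys ! i < ys ! j)"

definition contains_pattern :: "nat list \<Rightarrow> nat list \<Rightarrow> bool" where
  "contains_pattern \<pi> \<sigma> \<longleftrightarrow> (\<exists>ys. subseq ys \<pi> \<and> order_isomorphic ys \<sigma>)"

definition standardize :: "nat list \<Rightarrow> nat list" where
  "standardize w = map (\<lambda>x. card {y \<in> set w. y \<le> x}) w"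

text \<open>In the binary string of a template, \<^const>\<open>False\<close> is the digit 0 and \<^const>\<open>True\<close> the digit 1.\<close>

type_synonym template = "nat list \<times> bool list"

definition is_template :: "template \<Rightarrow> bool" where
  "is_template T \<longleftrightarrow> (case T of (P, B) \<Rightarrow>
     length P \<ge> 1 \<and> P \<in> permutations_of_set {1..length P} \<and> length B = length P)"

definition divides_by :: "template \<Rightarrow> nat list list \<Rightarrow> nat list \<Rightarrow> bool" where
  "divides_by T Ws \<pi> \<longleftrightarrow> (case T of (P, B) \<Rightarrow>
     length Ws = length P \<and> \<pi> = concat Ws \<and>
     (\<forall>i<length P. \<forall>j<length P. P ! i > P ! j \<longrightarrow>
        (\<forall>x\<in>set (Ws ! i). \<forall>y\<in>set (Ws ! j). x > y)) \<and>
     (\<forall>i<length P. B ! i = False \<longrightarrow> length (Ws ! i) = 1))"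

text \<open>
  Blocks may be empty, so a block can be all of \<open>\<pi>\<close>, and the recursion is not on the length
  alone; the sets are the least ones closed under the rules. Dividing \<open>\<pi>\<close> into itself and
  empty blocks therefore never yields a new permutation.
\<close>

inductive generated :: "template set \<Rightarrow> nat \<Rightarrow> nat list \<Rightarrow> bool" for \<T> :: "template set" where
  empty: "generated \<T> 0 []"
| single: "generated \<T> 1 [1]"
| inflate: "\<lbrakk>n \<ge> 2; \<pi> \<in> permutations_of_set {1..n}; T \<in> \<T>; divides_by T Ws \<pi>;
     \<forall>W\<in>set Ws. generated \<T> (length W) (standardize W)\<rbrakk> \<Longrightarrow> generated \<T> n \<pi>"

definition template_class :: "nat \<Rightarrow> template set \<Rightarrow> nat list set" where
  "template_class n \<T> = {\<pi>. generated \<T> n \<pi>}"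

lemma generated_iff:
  "generated \<T> n \<pi> \<longleftrightarrow> n = 0 \<and> \<pi> = [] \<or> n = 1 \<and> \<pi> = [1] \<or>
     n \<ge> 2 \<and> \<pi> \<in> permutations_of_set {1..n} \<and> (\<exists>T\<in>\<T>. \<exists>Ws. divides_by T Ws \<pi> \<and>
       (\<forall>W\<in>set Ws. generated \<T> (length W) (standardize W)))"
  by (subst generated.simps) blast

lemma template_class_0: "template_class 0 \<T> = {[]}"
  using generated_iff[of \<T> 0] by (simp add: template_class_def set_eq_iff)

lemma template_class_1: "template_class 1 \<T> = {[1]}"
  using generated_iff[of \<T> 1] by (simp add: template_class_def set_eq_iff)

lemma template_class_rec:
  assumes "n \<ge> 2"
  shows "template_class n \<T> = {\<pi> \<in> permutations_of_set {1..n}. \<exists>T\<in>\<T>. \<exists>Ws.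
    divides_by T Ws \<pi> \<and> (\<forall>W\<in>set Ws. standardize W \<in> template_class (length W) \<T>)}"
proof -
  have "n \<noteq> 0" "n \<noteq> 1" using assms by simp_all
  then show ?thesis
    using generated_iff[of \<T> n] assms
    unfolding template_class_def mem_Collect_eq by blast
qed

end

theory Submission
  imports Defs
begin

text \<open>
  Fix an occurrence of \<open>\<sigma>\<close> in a generated permutation and descend through its derivation as long
  as one block contains the whole occurrence. When the occurrence is split into
  parts of sizes \<open>l\<^sub>1, \<dots>, l\<^sub>s\<close> in \<open>s \<ge> 2\<close> blocks, replace each of these blocks by
  a generated one of size at most \<open>(l\<^sub>j - 1)(k + 1) + 1\<close>, each unused block with digit 1 by the
  empty block, and keep the at most \<open>k\<close> unused singletons. The total is at most
  \<open>l (k + 1) - s k + k \<le> (l - 1)(k + 1) + 1\<close>.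
\<close>

section \<open>Order isomorphism\<close>

text \<open>Pairs of corresponding entries replace positions here. Zipping commutes with
  concatenation of blocks of matching lengths, so this form needs no index arithmetic across
  blocks.\<close>

lemma order_isomorphic_iff_zip:
  "order_isomorphic xs ys \<longleftrightarrow> length xs = length ys \<and>
     (\<forall>p\<in>set (zip xs ys). \<forall>q\<in>set (zip xs ys). fst p < fst q \<longleftrightarrow> snd p < snd q)"
  unfolding order_isomorphic_def set_zip by fastforce

lemma order_isomorphic_trans:
  "order_isomorphic xs ys \<Longrightarrow> order_isomorphic ys zs \<Longrightarrow> order_isomorphic xs zs"
  unfolding order_isomorphic_def by auto

lemma order_isomorphic_map:
  assumes "strict_mono_on (set xs) f"
  shows "order_isomorphic (map f xs) xs"
  unfolding order_isomorphic_def
  using strict_mono_on_less[OF assms] by simp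

lemma zip_concat:
  assumes "list_all2 (\<lambda>x y. length x = length y) xss yss"
  shows "zip (concat xss) (concat yss) = concat (map2 zip xss yss)"
  using assms by (induction rule: list_all2_induct) simp_all

text \<open>Two entries of the same block compare alike because corresponding blocks are
  order-isomorphic. Entries of different blocks compare as the values of \<open>P\<close> do, in
  both families; \<open>distinct P\<close> makes those values differ.\<close>

lemma order_isomorphic_concat:
  fixes P :: "'a::linorder list"
  assumes len: "length Ys = length P" "length Zs = length P" and "distinct P"
    and iso: "\<And>i. i < length P \<Longrightarrow> order_isomorphic (Zs ! i) (Ys ! i)"
    and Y: "\<And>i j x y. \<lbrakk>i < length P; j < length P; P ! i > P ! j; x \<in> set (Ys ! i); y \<in> set (Ys ! j)\<rbrakk>
              \<Longrightarrow> x > y"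
    and Z: "\<And>i j x y. \<lbrakk>i < length P; j < length P; P ! i > P ! j; x \<in> set (Zs ! i); y \<in> set (Zs ! j)\<rbrakk>
              \<Longrightarrow> x > y"
  shows "order_isomorphic (concat Zs) (concat Ys)"
proof -
  have "length (Zs ! i) = length (Ys ! i)" if "i < length P" for i
    using iso[OF that] by (simp add: order_isomorphic_def)
  then have all2: "list_all2 (\<lambda>x y. length x = length y) Zs Ys"
    using len by (simp add: list_all2_conv_all_nth)
  have zip: "\<exists>i<length P. p \<in> set (zip (Zs ! i) (Ys ! i))"
    if "p \<in> set (zip (concat Zs) (concat Ys))" for p
    using that len unfolding zip_concat[OF all2] by (auto simp: set_zip)
  have "fst p < fst q \<longleftrightarrow> snd p < snd q"
    if pq: "p \<in> set (zip (concat Zs) (concat Ys))" "q \<in> set (zip (concat Zs) (concat Ys))" for p q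
  proof -
    obtain i where i: "i < length P" "p \<in> set (zip (Zs ! i) (Ys ! i))" using zip pq by blast
    obtain j where j: "j < length P" "q \<in> set (zip (Zs ! j) (Ys ! j))" using zip pq by blast
    have mem: "fst p \<in> set (Zs ! i)" "snd p \<in> set (Ys ! i)" "fst q \<in> set (Zs ! j)" "snd q \<in> set (Ys ! j)"
      using i(2) j(2) by (metis prod.collapse set_zip_leftD set_zip_rightD)+
    consider "i = j" | "P ! i < P ! j" | "P ! j < P ! i"
      using nth_eq_iff_index_eq[OF \<open>distinct P\<close> i(1) j(1)] linorder_less_linear[of "P ! i" "P ! j"]
      by blast
    then show ?thesis
    proof cases
      case 1
      then show ?thesis using iso[OF i(1)] i(2) j(2) unfolding order_isomorphic_iff_zip by blast
    next
      case 2
      then show ?thesis using Y[OF j(1) i(1) 2] Z[OF j(1) i(1) 2] mem by blast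
    next
      case 3
      then show ?thesis using Y[OF i(1) j(1) 3] Z[OF i(1) j(1) 3] mem by (meson order_less_asym)
    qed
  qed
  moreover have "length (concat Zs) = length (concat Ys)"
    using all2 by (induction rule: list_all2_induct) simp_all
  ultimately show ?thesis unfolding order_isomorphic_iff_zip by blast
qed

section \<open>Standardization\<close>

text \<open>For x < y in \<open>A\<close>, the elements up to x form a proper subset of those up to
  y, since y lies only in the latter. This rank is the map that \<open>standardize\<close> applies
  entrywise.\<close>

lemma strict_mono_on_rank:
  "finite A \<Longrightarrow> strict_mono_on A (\<lambda>x::nat. card {y \<in> A. y \<le> x})"
  by (intro strict_mono_onI psubset_card_mono psubsetI) (auto simp: set_eq_iff not_le[symmetric])

text \<open>On the entries, \<open>f\<close> is a bijection from those up to x onto the images up to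
  \<open>f x\<close>, so ranks do not change.\<close>

lemma standardize_map:
  assumes "strict_mono_on (set w) f"
  shows "standardize (map f w) = standardize w"
proof -
  have "card {y \<in> f ` set w. y \<le> f x} = card {y \<in> set w. y \<le> x}" if "x \<in> set w" for x
  proof -
    have "{y \<in> f ` set w. y \<le> f x} = f ` {y \<in> set w. y \<le> x}"
      using strict_mono_on_less_eq[OF assms] that by auto
    moreover have "inj_on f {y \<in> set w. y \<le> x}"
      using strict_mono_on_imp_inj_on[OF assms] by (rule inj_on_subset) auto
    ultimately show ?thesis by (simp add: card_image)
  qed
  then show ?thesis by (simp add: standardize_def)
qed

lemma standardize_permutation:
  assumes "\<pi> \<in> permutations_of_set {1..n}"
  shows "standardize \<pi> = \<pi>"
proof -
  have set: "set \<pi> = {1..n}" using assms by (rule permutations_of_setD)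
  have "{y \<in> {1..n}. y \<le> x} = {1..x}" if "x \<in> {1..n}" for x using that by auto
  then show ?thesis unfolding standardize_def set by (intro map_idI) (simp add: set)
qed

text \<open>The ranks are pairwise distinct and lie between 1 and \<open>length w\<close>, so by
  counting they fill the whole interval.\<close>

lemma standardize_in_permutations:
  assumes "distinct w"
  shows "standardize w \<in> permutations_of_set {1..length w}"
proof (rule permutations_of_setI)
  let ?r = "\<lambda>x. card {y \<in> set w. y \<le> x}"
  have inj: "inj_on ?r (set w)"
    by (rule strict_mono_on_imp_inj_on[OF strict_mono_on_rank]) simp
  then show "distinct (standardize w)"
    using assms by (simp add: standardize_def distinct_map)
  have "?r x \<in> {1..length w}" if "x \<in> set w" for x
  proof -
    have "?r x > 0" using that by (auto simp: card_gt_0_iff)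
    moreover have "?r x \<le> card (set w)" by (intro card_mono) auto
    ultimately show ?thesis using distinct_card[OF assms] by (simp add: Suc_le_eq)
  qed
  then have "?r ` set w \<subseteq> {1..length w}" by auto
  moreover have "card (?r ` set w) = length w"
    using card_image[OF inj] distinct_card[OF assms] by simp
  ultimately show "set (standardize w) = {1..length w}"
    by (simp add: standardize_def card_subset_eq)
qed

section \<open>Subsequences of concatenations\<close>

text \<open>Cuts an occurrence at the block boundaries; a part may be empty.\<close>

lemma subseq_concatE:
  assumes "subseq ys (concat Ws)"
  obtains Ys where "ys = concat Ys" "list_all2 subseq Ys Ws"
  using assms
proof (induction Ws arbitrary: ys thesis)
  case Nil
  then show ?case by simp
next
  case (Cons W Ws)
  from Cons.prems(2) obtain u v where "ys = u @ v" "subseq u W" "subseq v (concat Ws)"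
    by (auto elim: subseq_appendE)
  then show ?case using Cons.IH[of v] Cons.prems(1) by (metis concat.simps(2) list_all2_Cons)
qed

lemma subseq_concat_mono: "list_all2 subseq Ys Ws \<Longrightarrow> subseq (concat Ys) (concat Ws)"
  by (induction rule: list_all2_induct) (simp_all add: list_emb_append_mono)

lemma subseq_concat_nth: "i < length Ys \<Longrightarrow> subseq (Ys ! i) (concat Ys)"
proof (induction Ys arbitrary: i)
  case (Cons Y Ys)
  then show ?case by (cases i) (auto intro: list_emb_append2)
qed simp

lemma length_concat_eq_sum: "length (concat Ws) = (\<Sum>i<length Ws. length (Ws ! i))"
  by (simp add: length_concat sum_list_sum_nth atLeast0LessThan)

lemma count_list_False_eq_sum: "count_list B False = (\<Sum>i<length B. of_bool (\<not> B ! i))"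
proof (induction B)
  case (Cons b B)
  then show ?case by (simp add: sum.lessThan_Suc_shift del: sum.lessThan_Suc sum_of_bool_eq)
qed simp

section \<open>Reassembling blocks\<close>

lemma generated_permutation: "generated \<T> n \<pi> \<Longrightarrow> \<pi> \<in> permutations_of_set {1..n}"
  by (induction rule: generated.induct) (auto simp: permutations_of_set_def)

lemma generated_length: "generated \<T> n \<pi> \<Longrightarrow> length \<pi> = n"
  using length_finite_permutations_of_set[OF generated_permutation] by simp

text \<open>Copies of the \<open>Us ! i\<close> are shifted into disjoint ranges of values, ordered
  as \<open>P\<close> prescribes, and their concatenation is standardized. Occurrences of the
  \<open>Ys ! i\<close> follow the same two strictly monotone maps, and their concatenation is
  ordered between blocks as \<open>concat Ys\<close> is.\<close>

lemma generated_reassemble: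
  assumes T: "(P, B) \<in> \<T>" "is_template (P, B)"
    and Us: "length Us = length P" "\<And>i. i < length P \<Longrightarrow> generated \<T> (length (Us ! i)) (Us ! i)"
    and single: "\<And>i. i < length P \<Longrightarrow> \<not> B ! i \<Longrightarrow> length (Us ! i) = 1"
    and len2: "length (concat Us) \<ge> 2"
    and Ys: "length Ys = length P"
      "\<And>i. i < length P \<Longrightarrow> contains_pattern (Us ! i) (Ys ! i)"
      "\<And>i j x y. \<lbrakk>i < length P; j < length P; P ! i > P ! j; x \<in> set (Ys ! i); y \<in> set (Ys ! j)\<rbrakk>
              \<Longrightarrow> x > y"
  shows "\<exists>\<pi>. generated \<T> (length (concat Us)) \<pi> \<and> contains_pattern \<pi> (concat Ys)"
proof -
  have dP: "distinct P" using T(2) by (auto simp: is_template_def permutations_of_set_def)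
  \<comment> \<open>\<open>M\<close> exceeds every entry of every block, so adding
    \<open>P ! i * M\<close> moves block i into the values from \<open>P ! i * M\<close> up to, but
    excluding, \<open>Suc (P ! i) * M\<close>.\<close>
  define M where "M = Suc (Max (insert 0 (set (concat Us))))"
  have lt_M: "x < M" if "x \<in> set (Us ! i)" "i < length P" for x i
  proof -
    have "x \<in> set (concat Us)" using that Us(1) by auto
    then show ?thesis unfolding M_def by (auto intro!: le_imp_less_Suc Max_ge)
  qed
  define s where "s i x = x + P ! i * M" for i x
  define Vs where "Vs = map (\<lambda>i. map (s i) (Us ! i)) [0..<length P]"
  have lenV: "length Vs = length P" and nthV: "\<And>i. i < length P \<Longrightarrow> Vs ! i = map (s i) (Us ! i)"
    by (simp_all add: Vs_def)
  have order_s: "s i x > s j y"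
    if "P ! i > P ! j" "j < length P" "y \<in> set (Us ! j)" for i j x y
  proof -
    have "s j y < M + P ! j * M" using lt_M that by (simp add: s_def)
    also have "\<dots> = Suc (P ! j) * M" by simp
    also have "\<dots> \<le> P ! i * M" using that(1) by (intro mult_le_mono1) simp
    also have "\<dots> \<le> s i x" by (simp add: s_def)
    finally show ?thesis .
  qed
  have order_V: "u > v"
    if "i < length P" "j < length P" "P ! i > P ! j" "u \<in> set (Vs ! i)" "v \<in> set (Vs ! j)" for i j u v
    using that order_s by (auto simp: nthV)
  have inj_s: "inj (s i)" for i by (simp add: inj_on_def s_def)
  have len_conc: "length (concat Vs) = length (concat Us)"
    using lenV nthV Us(1) by (simp add: length_concat_eq_sum)
  have distinct_U: "distinct (Us ! i)" if "i < length P" for i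
    using generated_permutation[OF Us(2)[OF that]] by (rule permutations_of_setD)
  have disj: "set (Vs ! i) \<inter> set (Vs ! j) = {}" if "i < length P" "j < length P" "i \<noteq> j" for i j
  proof -
    have "P ! i > P ! j \<or> P ! j > P ! i"
      using nth_eq_iff_index_eq[OF dP that(1,2)] that(3) linorder_less_linear[of "P ! i" "P ! j"]
      by blast
    then show ?thesis using order_V[of i j] order_V[of j i] that by (meson disjoint_iff less_irrefl)
  qed
  \<comment> \<open>The blocks are distinct lists with pairwise disjoint entries, so the number of
    values equals the total length, which forces distinctness.\<close>
  have "distinct (concat Vs)"
  proof -
    have "sum_list (map length Vs) = card (set (concat Vs))"
    proof -
      have "card (set (concat Vs)) = card (\<Union>i<length P. set (Vs ! i))"
        by (rule arg_cong[where f = card]) (auto simp: Vs_def)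
      also have "\<dots> = (\<Sum>i<length P. card (set (Vs ! i)))"
        using disj by (intro card_UN_disjoint) auto
      also have "\<dots> = (\<Sum>i<length P. length (Vs ! i))"
        using distinct_U nthV inj_s
        by (intro sum.cong refl distinct_card) (simp add: distinct_map inj_on_subset[OF _ subset_UNIV])
      finally show ?thesis by (simp add: sum_list_sum_nth atLeast0LessThan lenV)
    qed
    then show ?thesis by (intro card_distinct) (simp add: length_concat)
  qed
  \<comment> \<open>\<open>g\<close> is the rank in the whole concatenation. Since it acts
    entrywise, it can be applied block by block, which displays the division of \<open>\<pi>\<close>
    into blocks.\<close>
  define g where "g x = card {y \<in> set (concat Vs). y \<le> x}" for x
  have g_mono: "strict_mono_on (set (concat Vs)) g"
    unfolding g_def by (rule strict_mono_on_rank) simp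
  have V_sub: "set (Vs ! i) \<subseteq> set (concat Vs)" if "i < length P" for i
    unfolding set_concat using that lenV by (intro UN_upper nth_mem) simp
  define \<pi> where "\<pi> = standardize (concat Vs)"
  have \<pi>: "\<pi> = concat (map (map g) Vs)"
    unfolding \<pi>_def standardize_def g_def[symmetric] map_concat ..
  have "generated \<T> (length (concat Us)) \<pi>"
  proof (rule generated.inflate[OF len2 _ T(1)])
    show "\<pi> \<in> permutations_of_set {1..length (concat Us)}"
      using standardize_in_permutations[OF \<open>distinct (concat Vs)\<close>] len_conc by (simp add: \<pi>_def)
    have "g (s i x) > g (s j y)"
      if "i < length P" "j < length P" "P ! i > P ! j" "x \<in> set (Us ! i)" "y \<in> set (Us ! j)" for i j x y
    proof (rule strict_mono_onD[OF g_mono])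
      show "s j y \<in> set (concat Vs)" "s i x \<in> set (concat Vs)"
        using V_sub[of i] V_sub[of j] nthV that by auto
      show "s i x > s j y" using order_s that by blast
    qed
    then show "divides_by (P, B) (map (map g) Vs) \<pi>"
      unfolding divides_by_def using single by (auto simp: \<pi> lenV nthV)
    show "\<forall>W\<in>set (map (map g) Vs). generated \<T> (length W) (standardize W)"
    proof
      fix W assume "W \<in> set (map (map g) Vs)"
      then obtain i where i: "i < length P" "W = map g (Vs ! i)"
        by (auto simp: in_set_conv_nth lenV)
      \<comment> \<open>Both \<open>g\<close> and the shift \<open>s i\<close> are strictly monotone
        on the entries concerned, so standardizing the block undoes them and gives back the
        generated permutation \<open>Us ! i\<close>.\<close>
      have "standardize W = standardize (Vs ! i)"
        unfolding i(2) by (rule standardize_map[OF monotone_on_subset[OF g_mono V_sub[OF i(1)]]])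
      also have "\<dots> = standardize (Us ! i)"
        unfolding nthV[OF i(1)] by (rule standardize_map) (simp add: strict_mono_on_def s_def)
      also have "\<dots> = Us ! i"
        by (rule standardize_permutation[OF generated_permutation[OF Us(2)[OF i(1)]]])
      finally show "generated \<T> (length W) (standardize W)"
        using Us(2)[OF i(1)] i by (simp add: nthV)
    qed
  qed
  moreover have "contains_pattern \<pi> (concat Ys)"
  proof -
    have "\<forall>i. \<exists>Z. i < length P \<longrightarrow> subseq Z (Us ! i) \<and> order_isomorphic Z (Ys ! i)"
      using Ys(2) unfolding contains_pattern_def by blast
    then obtain Z where Z: "\<And>i. i < length P \<Longrightarrow> subseq (Z i) (Us ! i)"
      "\<And>i. i < length P \<Longrightarrow> order_isomorphic (Z i) (Ys ! i)" by metis
    \<comment> \<open>The chosen occurrences get the same shifts as the blocks containing them;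
      \<open>g\<close> then carries the result into \<open>\<pi>\<close>.\<close>
    define Zs where "Zs = map (\<lambda>i. map (s i) (Z i)) [0..<length P]"
    have lenZ: "length Zs = length P" and nthZ: "\<And>i. i < length P \<Longrightarrow> Zs ! i = map (s i) (Z i)"
      by (simp_all add: Zs_def)
    have sub: "subseq (concat Zs) (concat Vs)"
      by (rule subseq_concat_mono) (simp add: list_all2_conv_all_nth lenZ lenV nthZ nthV subseq_map Z)
    have "order_isomorphic (concat Zs) (concat Ys)"
    proof (rule order_isomorphic_concat[OF Ys(1) lenZ dP])
      fix i assume "i < length P"
      then show "order_isomorphic (Zs ! i) (Ys ! i)"
        unfolding nthZ[OF \<open>i < length P\<close>]
        by (intro order_isomorphic_trans[OF order_isomorphic_map Z(2)])
          (simp_all add: strict_mono_on_def s_def)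
    next
      fix i j x y
      assume ij: "i < length P" "j < length P" "P ! i > P ! j" "x \<in> set (Zs ! i)" "y \<in> set (Zs ! j)"
      then obtain x' y' where "x = s i x'" "y = s j y'" "y' \<in> set (Z j)" by (auto simp: nthZ)
      moreover have "set (Z j) \<subseteq> set (Us ! j)"
        using Z(1)[OF ij(2)] by (auto dest: list_emb_set)
      ultimately show "x > y" using order_s ij by blast
    qed (use Ys(3) in blast)
    moreover have "order_isomorphic (map g (concat Zs)) (concat Zs)"
    proof (rule order_isomorphic_map, rule monotone_on_subset[OF g_mono])
      show "set (concat Zs) \<subseteq> set (concat Vs)" using sub by (blast dest: list_emb_set)
    qed
    moreover have "subseq (map g (concat Zs)) \<pi>"
      using subseq_map[OF sub, of g] by (simp add: \<pi> map_concat)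
    ultimately show ?thesis unfolding contains_pattern_def using order_isomorphic_trans by blast
  qed
  ultimately show ?thesis by blast
qed

section \<open>The size bound\<close>

lemma sum_block_bound:
  fixes a c :: "nat \<Rightarrow> nat" and z :: "nat \<Rightarrow> bool"
  assumes pos: "(\<Sum>i<t. a i) > 0" and split: "\<And>i. i < t \<Longrightarrow> a i \<noteq> (\<Sum>i<t. a i)"
    and zeros: "(\<Sum>i<t. of_bool (z i)) \<le> k"
    and c_used: "\<And>i. i < t \<Longrightarrow> a i > 0 \<Longrightarrow> c i \<le> (a i - 1) * (k + 1) + 1"
    and c_unused: "\<And>i. i < t \<Longrightarrow> a i = 0 \<Longrightarrow> c i \<le> of_bool (z i)"
  shows "(\<Sum>i<t. c i) \<le> ((\<Sum>i<t. a i) - 1) * (k + 1) + 1"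
proof -
  define l where "l = (\<Sum>i<t. a i)"
  have "\<exists>i<t. a i > 0" using pos by (metis gr0I lessThan_iff sum.neutral less_irrefl)
  then obtain i where i: "i < t" "a i > 0" by blast
  \<comment> \<open>Block i does not carry the whole sum, so the remainder is nonzero and yields a
    second used block.\<close>
  have "l = a i + (\<Sum>j\<in>{..<t} - {i}. a j)"
    unfolding l_def using i(1) by (intro sum.remove) auto
  then have "(\<Sum>j\<in>{..<t} - {i}. a j) \<noteq> 0" using split[OF i(1)] l_def by simp
  then obtain j where j: "j < t" "j \<noteq> i" "a j > 0" by auto
  have "2 = card {i, j}" using j(2) by simp
  also have "\<dots> \<le> card {i \<in> {..<t}. a i > 0}" using i j by (intro card_mono) auto
  also have "\<dots> = (\<Sum>i<t. of_bool (a i > 0))" by (simp add: sum_of_bool_eq Int_def)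
  finally have two: "2 * k \<le> (\<Sum>i<t. of_bool (a i > 0)) * k" by (rule mult_le_mono1)
  \<comment> \<open>The savings stand on the left and the cost on the right, so that no subtraction
    of naturals enters the sums.\<close>
  have "c i + of_bool (a i > 0) * k \<le> a i * (k + 1) + of_bool (z i)" if "i < t" for i
  proof (cases "a i")
    case 0
    then show ?thesis using c_unused[OF that] by simp
  next
    case (Suc b)
    then show ?thesis using c_used[OF that] by simp
  qed
  then have "(\<Sum>i<t. c i + of_bool (a i > 0) * k) \<le> (\<Sum>i<t. a i * (k + 1) + of_bool (z i))"
    by (intro sum_mono) simp
  then have "(\<Sum>i<t. c i) + (\<Sum>i<t. of_bool (a i > 0)) * k \<le> l * (k + 1) + (\<Sum>i<t. of_bool (z i))"
    by (simp only: sum.distrib sum_distrib_right l_def)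
  then have "(\<Sum>i<t. c i) + 2 * k \<le> l * (k + 1) + k" using two zeros by linarith
  moreover have "l * (k + 1) = (l - 1) * (k + 1) + (k + 1)" using pos by (cases l) (simp_all add: l_def)
  ultimately show ?thesis unfolding l_def by linarith
qed

text \<open>The induction follows the derivation, as a block may be as long as \<open>\<pi>\<close>
  itself. The claim is about an actual occurrence \<open>ys\<close>, arbitrary in the induction,
  because its parts are occurrences in the blocks.\<close>

lemma generated_small_witness:
  assumes templates: "\<And>P B. (P, B) \<in> \<T> \<Longrightarrow> is_template (P, B) \<and> count_list B False \<le> k"
    and "generated \<T> n \<pi>" "subseq ys \<pi>" "ys \<noteq> []"
  shows "\<exists>m \<pi>'. m \<le> (length ys - 1) * (k + 1) + 1 \<and> generated \<T> m \<pi>' \<and> contains_pattern \<pi>' ys"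
  using assms(2-)
proof (induction arbitrary: ys rule: generated.induct)
  case empty
  then show ?case by simp
next
  case single
  have "contains_pattern [1] ys"
    unfolding contains_pattern_def order_isomorphic_def using single.prems(1) by blast
  then show ?case using generated.single by fastforce
next
  case (inflate n \<pi> T Ws)
  obtain P B where "T = (P, B)" by (cases T)
  have T: "(P, B) \<in> \<T>" "is_template (P, B)" "count_list B False \<le> k" "length B = length P"
    using inflate.hyps(3) templates[of P B] by (simp_all add: is_template_def \<open>T = (P, B)\<close>)
  have Ws: "length Ws = length P" "\<pi> = concat Ws"
    "\<And>i j x y. \<lbrakk>i < length P; j < length P; P ! i > P ! j; x \<in> set (Ws ! i); y \<in> set (Ws ! j)\<rbrakk> \<Longrightarrow> x > y"
    "\<And>i. i < length P \<Longrightarrow> \<not> B ! i \<Longrightarrow> length (Ws ! i) = 1"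
    using inflate.hyps(4) unfolding divides_by_def \<open>T = (P, B)\<close> prod.case by blast+
  obtain Ys where Ys: "ys = concat Ys" "list_all2 subseq Ys Ws"
    using inflate.prems(1) Ws(2) by (blast elim: subseq_concatE)
  have lenY: "length Ys = length P" and subY: "\<And>i. i < length P \<Longrightarrow> subseq (Ys ! i) (Ws ! i)"
    using Ys(2) Ws(1) by (auto simp: list_all2_conv_all_nth)
  \<comment> \<open>The induction hypothesis concerns the standardized block, so the part
    \<open>Ys ! i\<close> is replaced by its ranks \<open>?r\<close> in the block and recovered
    afterwards by order isomorphism.\<close>
  have IH: "\<exists>U. generated \<T> (length U) U \<and> length U \<le> (length (Ys ! i) - 1) * (k + 1) + 1 \<and>
      contains_pattern U (Ys ! i)" if i: "i < length P" and ne: "Ys ! i \<noteq> []" for i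
  proof -
    let ?W = "Ws ! i" and ?r = "\<lambda>x. card {y \<in> set (Ws ! i). y \<le> x}"
    have "?W \<in> set Ws" using i Ws(1) by simp
    moreover have "subseq (map ?r (Ys ! i)) (standardize ?W)"
      unfolding standardize_def using subY[OF i] by (rule subseq_map)
    ultimately obtain m U where U: "m \<le> (length (map ?r (Ys ! i)) - 1) * (k + 1) + 1"
      "generated \<T> m U" "contains_pattern U (map ?r (Ys ! i))"
      using inflate.IH ne by (meson map_is_Nil_conv)
    have "set (Ys ! i) \<subseteq> set ?W" using subY[OF i] by (auto dest: list_emb_set)
    then have "order_isomorphic (map ?r (Ys ! i)) (Ys ! i)"
      by (intro order_isomorphic_map monotone_on_subset[OF strict_mono_on_rank]) auto
    then have "contains_pattern U (Ys ! i)"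
      using U(3) order_isomorphic_trans unfolding contains_pattern_def by blast
    then show ?thesis using U generated_length[OF U(2)] by auto
  qed
  show ?case
  \<comment> \<open>If one block holds the whole occurrence, the witness for that block already
    serves; otherwise at least two blocks are used and a new permutation is assembled.\<close>
  proof (cases "\<exists>i<length P. length (Ys ! i) = length ys")
    case True
    then obtain i where i: "i < length P" "length (Ys ! i) = length ys" by blast
    then have "Ys ! i = ys"
      using subseq_concat_nth[of i Ys] lenY Ys(1) by (simp add: subseq_same_length)
    then show ?thesis using IH[OF i(1)] inflate.prems(2) by auto
  next
    case False
    let ?small = "\<lambda>i U. generated \<T> (length U) U \<and> contains_pattern U (Ys ! i) \<and>
        (length (Ys ! i) > 0 \<longrightarrow> length U \<le> (length (Ys ! i) - 1) * (k + 1) + 1) \<and>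
        (length (Ys ! i) = 0 \<longrightarrow> length U \<le> of_bool (\<not> B ! i)) \<and>
        (\<not> B ! i \<longrightarrow> length U = 1)"
    have ex: "\<exists>U. ?small i U" if i: "i < length P" for i
    proof (cases "Ys ! i = []")
      case True
      have "contains_pattern V []" for V
        by (auto simp: contains_pattern_def order_isomorphic_def)
      then show ?thesis using True generated.empty[of \<T>] generated.single[of \<T>]
        by (intro exI[of _ "if B ! i then [] else [1]"]) simp
    next
      case ne: False
      obtain U where U: "generated \<T> (length U) U"
        "length U \<le> (length (Ys ! i) - 1) * (k + 1) + 1" "contains_pattern U (Ys ! i)"
        using IH[OF i ne] by blast
      \<comment> \<open>In a used block with digit 0 the part has exactly one entry. The inductive
        bound is then 1, while containing the part requires length at least 1.\<close>
      have "length U = 1" if "\<not> B ! i"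
      proof -
        have "length (Ys ! i) \<le> 1" using Ws(4)[OF i that] subY[OF i] list_emb_length by fastforce
        moreover have "length (Ys ! i) \<le> length U"
          using U(3) unfolding contains_pattern_def order_isomorphic_def
          by (metis list_emb_length)
        moreover have "length (Ys ! i) > 0" using ne by simp
        ultimately have "length (Ys ! i) = 1" "length U \<ge> 1" by linarith+
        then show ?thesis using U(2) by simp
      qed
      then show ?thesis using U ne by auto
    qed
    define U where "U i = (SOME V. ?small i V)" for i
    have "?small i (U i)" if "i < length P" for i
      unfolding U_def by (rule someI_ex[OF ex[OF that]])
    then have U: "\<And>i. i < length P \<Longrightarrow> generated \<T> (length (U i)) (U i)"
      "\<And>i. i < length P \<Longrightarrow> contains_pattern (U i) (Ys ! i)"
      "\<And>i. i < length P \<Longrightarrow> length (Ys ! i) > 0 \<Longrightarrow> length (U i) \<le> (length (Ys ! i) - 1) * (k + 1) + 1"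
      "\<And>i. i < length P \<Longrightarrow> length (Ys ! i) = 0 \<Longrightarrow> length (U i) \<le> of_bool (\<not> B ! i)"
      "\<And>i. i < length P \<Longrightarrow> \<not> B ! i \<Longrightarrow> length (U i) = 1"
      by blast+
    define Us where "Us = map U [0..<length P]"
    have lenU: "length Us = length P" and nthU: "\<And>i. i < length P \<Longrightarrow> Us ! i = U i"
      by (simp_all add: Us_def)
    have sumY: "length ys = (\<Sum>i<length P. length (Ys ! i))"
      by (simp add: Ys(1) length_concat_eq_sum lenY)
    have bound: "length (concat Us) \<le> (length ys - 1) * (k + 1) + 1"
    proof -
      have "(\<Sum>i<length P. length (U i)) \<le> ((\<Sum>i<length P. length (Ys ! i)) - 1) * (k + 1) + 1"
      proof (rule sum_block_bound[where z = "\<lambda>i. \<not> B ! i"])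
        show "(\<Sum>i<length P. length (Ys ! i)) > 0"
          using inflate.prems(2) unfolding sumY[symmetric] by simp
        \<comment> \<open>The sum is \<open>length ys\<close>, and this case excludes a part of that
          length.\<close>
        show "length (Ys ! i) \<noteq> (\<Sum>i<length P. length (Ys ! i))" if "i < length P" for i
          using that False unfolding sumY[symmetric] by blast
        show "(\<Sum>i<length P. of_bool (\<not> B ! i)) \<le> k"
          using T(3,4) by (simp add: count_list_False_eq_sum)
      qed (use U in blast)+
      then show ?thesis by (simp add: length_concat_eq_sum lenU nthU sumY)
    qed
    \<comment> \<open>The rule \<open>inflate\<close> demands length at least 2. A single entry
      would lie entirely in one block, against the case assumption; and the assembled word is no
      shorter than \<open>ys\<close>, since each block contains its part.\<close>
    have "length ys \<ge> 2"
    proof (rule ccontr)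
      assume "\<not> length ys \<ge> 2"
      then have one: "length ys = 1" using inflate.prems(2) length_greater_0_conv[of ys] by linarith
      then have "\<exists>i<length P. length (Ys ! i) \<noteq> 0"
        unfolding sumY by (metis lessThan_iff sum.neutral zero_neq_one)
      then obtain i where i: "i < length P" "length (Ys ! i) \<noteq> 0" by blast
      have "length (Ys ! i) \<le> length ys"
        using subseq_concat_nth[of i Ys] i lenY Ys(1) list_emb_length by metis
      then show False using i one False by (metis le_antisym less_one linorder_not_le)
    qed
    moreover have "length ys \<le> length (concat Us)"
    proof -
      have "length (Ys ! i) \<le> length (U i)" if "i < length P" for i
        using U(2)[OF that] unfolding contains_pattern_def order_isomorphic_def
        by (metis list_emb_length)
      then show ?thesis by (auto simp: length_concat_eq_sum lenU nthU sumY intro: sum_mono)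
    qed
    ultimately have len2: "length (concat Us) \<ge> 2" by linarith
    have setY: "set (Ys ! i) \<subseteq> set (Ws ! i)" if "i < length P" for i
      using subY[OF that] by (auto dest: list_emb_set)
    have "\<exists>\<pi>. generated \<T> (length (concat Us)) \<pi> \<and> contains_pattern \<pi> (concat Ys)"
    proof (rule generated_reassemble[OF T(1,2) lenU _ _ len2 lenY])
      show "x > y" if "i < length P" "j < length P" "P ! i > P ! j"
        "x \<in> set (Ys ! i)" "y \<in> set (Ys ! j)" for i j x y
        using Ws(3)[OF that(1-3)] setY that by blast
    qed (use U nthU in simp_all)
    then show ?thesis using bound Ys(1) by blast
  qed
qed

theorem theorem6:
  fixes \<T> :: "template set" and k l :: nat and \<sigma> :: "nat list"
  assumes "finite \<T>"
    and "\<forall>T\<in>\<T>. is_template T"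
    and "\<forall>(P, B)\<in>\<T>. count_list B False \<le> k"
    and "l > 0"
    and "\<sigma> \<in> permutations_of_set {1..l}"
    and "\<exists>n. \<exists>\<pi>\<in>template_class n \<T>. contains_pattern \<pi> \<sigma>"
  shows "\<exists>m\<le>(l - 1) * (k + 1) + 1. \<exists>\<pi>\<in>template_class m \<T>. contains_pattern \<pi> \<sigma>"
proof -
  have "length \<sigma> = l" using assms(5) by (simp add: length_finite_permutations_of_set)
  obtain n \<pi> ys where \<pi>: "generated \<T> n \<pi>" "subseq ys \<pi>" "order_isomorphic ys \<sigma>"
    using assms(6) by (auto simp: template_class_def contains_pattern_def)
  then have "length ys = l" using \<open>length \<sigma> = l\<close> by (simp add: order_isomorphic_def)
  then have "ys \<noteq> []" using \<open>l > 0\<close> by auto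
  have "is_template (P, B) \<and> count_list B False \<le> k" if "(P, B) \<in> \<T>" for P B
    using assms(2,3) that by blast
  from generated_small_witness[OF this \<pi>(1,2) \<open>ys \<noteq> []\<close>] obtain m \<pi>' where
    m: "m \<le> (l - 1) * (k + 1) + 1" "generated \<T> m \<pi>'" "contains_pattern \<pi>' ys"
    using \<open>length ys = l\<close> by blast
  \<comment> \<open>The witness was built for the occurrence \<open>ys\<close>; its order
    isomorphism with \<open>\<sigma>\<close> transfers the containment.\<close>
  have "contains_pattern \<pi>' \<sigma>"
    using m(3) \<pi>(3) order_isomorphic_trans unfolding contains_pattern_def by blast
  then show ?thesis using m(1,2) by (auto simp: template_class_def)
qed

end
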